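(* Let $G$ and $H$ be two impartial games such that $G \equiv^-_{\mathcal{I}} H$. Then $G\equiv^-_{\mathcal{D}} H$.
   Context: A game is a finite two-player combinatorial game, defined recursively by $G=\{G^{\mathbf L}\mid G^{\mathbf R}\}$, where $G^{\mathbf L}$ and $G^{\mathbf R}$ are the finite sets of Left options and Right options, which are themselves games. The game $0=\{\cdot\mid\cdot\}$ has no options. The sum is $G+H=\{G^{\mathbf L}+H,\,G+H^{\mathbf L}\mid G^{\mathbf R}+H,\,G+H^{\mathbf R}\}$. Left and Right alternate moves. Under misère play, a player who cannot move on their turn wins. The misère outcome $o^-(G)$ is $\mathcal L$ (Left wins whoever starts), $\mathcal R$ (Right wins whoever starts), $\mathcal N$ (the first player wins) or $\mathcal P$ (the second player wins). Outcomes are partially ordered by $\mathcal R<\mathcal N<\mathcal L$ and $\mathcal R<\mathcal P<\mathcal L$, with $\mathcal N$ and $\mathcal P$ incomparable. For a set $\mathcal U$ of games and games $G,H$ (not necessarily in $\mathcal U$), $G\geqslant^-_{\mathcal U}H$ means $o^-(G+X)\geqslant o^-(H+X)$ for every $X\in\mathcal U$, and $G\equiv^-_{\mathcal U}H$ means $G\geqslant^-_{\mathcal U}H$ and $H\geqslant^-_{\mathcal U}G$. A game is dicot if it is $0$, or if it has both Left and Right options and all of them are dicot. A game is impartial if its set of Left options equals its set of Right options and all these options, if any, are impartial. $\mathcal D$ is the set of all dicot games and $\mathcal I$ is the set of all impartial games. *)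

theory Defs
  imports "HOL-Library.FSet"
begin

text \<open>
  Games are identified when they have literally the same option sets (identical game trees), not
  when they are equal in the normal-play sense; in particular, the equality of the two option sets
  in the definition of impartial games below is literal equality.
\<close>

datatype game = Game (left_opts: "game fset") (right_opts: "game fset")

lemma size_less_sum: "G |\<in>| A \<Longrightarrow> size G < (\<Sum>G'\<in>fset A. Suc (size G'))" for G :: game
  using member_le_sum[of G "fset A" "\<lambda>G'. Suc (size G')"] by simp

lemma size_left_opt [termination_simp]:
  "G |\<in>| A \<Longrightarrow> size G < Suc ((\<Sum>G'\<in>fset A. Suc (size G')) + n)" for G :: game
  using size_less_sum[of G A] by simp

lemma size_right_opt [termination_simp]:
  "G |\<in>| A \<Longrightarrow> size G < Suc (n + (\<Sum>G'\<in>fset A. Suc (size G')))" for G :: game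
  using size_less_sum[of G A] by simp

declare fimage_cong [fundef_cong]

instantiation game :: "{zero, plus}"
begin

definition zero_game :: game where
  "0 = Game {||} {||}"

fun plus_game :: "game \<Rightarrow> game \<Rightarrow> game" where
  "Game GL GR + Game HL HR =
     Game ((\<lambda>G'. G' + Game HL HR) |`| GL |\<union>| (\<lambda>H'. Game GL GR + H') |`| HL)
          ((\<lambda>G'. G' + Game HL HR) |`| GR |\<union>| (\<lambda>H'. Game GL GR + H') |`| HR)"

instance ..

end

datatype player = Left | Right

text \<open>
  \<open>wins_first p G\<close>: under misere play, player \<open>p\<close> has a winning strategy in \<open>G\<close> when
  \<open>p\<close> moves first.
\<close>

fun wins_first :: "player \<Rightarrow> game \<Rightarrow> bool" where
  "wins_first Left (Game GL GR) \<longleftrightarrow> GL = {||} \<or> (\<exists>G' |\<in>| GL. \<not> wins_first Right G')"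
| "wins_first Right (Game GL GR) \<longleftrightarrow> GR = {||} \<or> (\<exists>G' |\<in>| GR. \<not> wins_first Left G')"

datatype outcome = LeftWins | RightWins | NextWins | PreviousWins

instantiation outcome :: order
begin

definition less_eq_outcome :: "outcome \<Rightarrow> outcome \<Rightarrow> bool" where
  "x \<le> y \<longleftrightarrow> x = y \<or> x = RightWins \<or> y = LeftWins"

definition less_outcome :: "outcome \<Rightarrow> outcome \<Rightarrow> bool" where
  "x < y \<longleftrightarrow> x \<le> y \<and> x \<noteq> (y :: outcome)"

instance
  by standard (auto simp: less_eq_outcome_def less_outcome_def)

end

text \<open>Draws are impossible: the second player wins exactly when the first player does not.\<close>

definition misere_outcome :: "game \<Rightarrow> outcome" where
  "misere_outcome G =
     (if wins_first Left G
      then (if wins_first Right G then NextWins else LeftWins)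
      else (if wins_first Right G then RightWins else PreviousWins))"

definition misere_ge :: "game set \<Rightarrow> game \<Rightarrow> game \<Rightarrow> bool" where
  "misere_ge U G H \<longleftrightarrow> (\<forall>X\<in>U. misere_outcome (G + X) \<ge> misere_outcome (H + X))"

definition misere_equiv :: "game set \<Rightarrow> game \<Rightarrow> game \<Rightarrow> bool" where
  "misere_equiv U G H \<longleftrightarrow> misere_ge U G H \<and> misere_ge U H G"

inductive dicot :: "game \<Rightarrow> bool" where
  dicot_zero: "dicot 0"
| dicot_node: "GL \<noteq> {||} \<Longrightarrow> GR \<noteq> {||} \<Longrightarrow>
    (\<And>G'. G' |\<in>| GL \<Longrightarrow> dicot G') \<Longrightarrow> (\<And>G'. G' |\<in>| GR \<Longrightarrow> dicot G') \<Longrightarrow> dicot (Game GL GR)"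

inductive impartial :: "game \<Rightarrow> bool" where
  impartial_node: "(\<And>G'. G' |\<in>| A \<Longrightarrow> impartial G') \<Longrightarrow> impartial (Game A A)"

definition dicots :: "game set" where
  "dicots = {G. dicot G}"

definition impartials :: "game set" where
  "impartials = {G. impartial G}"

end

theory Submission
  imports Defs
begin

text \<open>
  Following Conway, two impartial games \<open>K\<close> and \<open>H\<close> such that \<open>K\<close> is equivalent to no option of
  \<open>H\<close> and no option of \<open>K\<close> is equivalent to \<open>H\<close> are linked: some impartial \<open>T\<close> makes both \<open>K + T\<close>
  and \<open>H + T\<close> second-player wins. If \<open>G\<close> and \<open>H\<close> are equivalent modulo impartial games, no option
  of \<open>G\<close> is linked to \<open>H\<close>, so every option of \<open>G\<close> is equivalent to an option of \<open>H\<close> or reverses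
  to a game equivalent to \<open>H\<close>. This lets a winning strategy on \<open>G + X\<close> be copied on \<open>H + X\<close>. For
  a dicot \<open>X\<close> a player can only run out of moves when \<open>X = 0\<close>, and \<open>0\<close> is impartial.
\<close>

section \<open>Options and outcomes, uniform in the player\<close>

fun opts :: "player \<Rightarrow> game \<Rightarrow> game fset" where
  "opts Left G = left_opts G"
| "opts Right G = right_opts G"

fun opponent :: "player \<Rightarrow> player" where
  "opponent Left = Right"
| "opponent Right = Left"

lemma opponent_opponent [simp]: "opponent (opponent p) = p"
  by (cases p) auto

lemma wins_first_iff:
  "wins_first p G \<longleftrightarrow>
     opts p G = {||} \<or> (\<exists>G' |\<in>| opts p G. \<not> wins_first (opponent p) G')"
  by (cases p; cases G) auto

lemma size_opts: "G' |\<in>| opts p G \<Longrightarrow> size G' < size G"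
  using size_left_opt size_right_opt by (cases p; cases G) auto

lemma opts_plus:
  "opts p (G + H) = (\<lambda>G'. G' + H) |`| opts p G |\<union>| (\<lambda>H'. G + H') |`| opts p H"
  by (cases p; cases G; cases H) auto

lemma opts_plus_empty_iff: "opts p (G + H) = {||} \<longleftrightarrow> opts p G = {||} \<and> opts p H = {||}"
  by (auto simp: opts_plus)

lemma misere_outcome_eq_iff:
  "misere_outcome G = misere_outcome H \<longleftrightarrow> (\<forall>p. wins_first p G = wins_first p H)"
proof -
  have "(\<forall>p. wins_first p G = wins_first p H) \<longleftrightarrow>
      wins_first Left G = wins_first Left H \<and> wins_first Right G = wins_first Right H"
    by (metis player.exhaust)
  then show ?thesis
    by (simp add: misere_outcome_def)
qed

text \<open>Antisymmetry of the outcome order turns the two inequalities into equality of outcomes,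
  and an outcome is determined by who wins for each choice of first player.\<close>

lemma misere_equiv_iff:
  "misere_equiv U G H \<longleftrightarrow> (\<forall>X\<in>U. \<forall>p. wins_first p (G + X) = wins_first p (H + X))"
  unfolding misere_equiv_def misere_ge_def misere_outcome_eq_iff [symmetric]
  by (auto intro: antisym)

lemma misere_equiv_sym: "misere_equiv U G H \<Longrightarrow> misere_equiv U H G"
  by (simp add: misere_equiv_def)

section \<open>Impartial games: who moves first is irrelevant\<close>

lemma impartial_opts_eq: "impartial G \<Longrightarrow> opts p G = left_opts G"
  by (cases p) (auto elim: impartial.cases)

lemma impartial_opt: "impartial G \<Longrightarrow> G' |\<in>| left_opts G \<Longrightarrow> impartial G'"
  by (auto elim: impartial.cases)

lemma impartialI:
  assumes "opts Right G = opts Left G" and "\<And>G'. G' |\<in>| opts Left G \<Longrightarrow> impartial G'"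
  shows "impartial G"
  using assms by (cases G) (auto intro: impartial_node)

lemma impartial_plus: "impartial G \<Longrightarrow> impartial H \<Longrightarrow> impartial (G + H)"
proof (induction "size G + size H" arbitrary: G H rule: less_induct)
  case less
  show ?case
  proof (rule impartialI)
    show "opts Right (G + H) = opts Left (G + H)"
      using less.prems by (simp only: opts_plus impartial_opts_eq)
  next
    fix K assume "K |\<in>| opts Left (G + H)"
    then consider G' where "G' |\<in>| left_opts G" "K = G' + H"
      | H' where "H' |\<in>| left_opts H" "K = G + H'"
      unfolding opts_plus by auto
    then show "impartial K"
      using less impartial_opt size_opts[of _ Left] by cases auto
  qed
qed

lemma impartial_wins_first: "impartial G \<Longrightarrow> wins_first p G = wins_first Left G"
proof (induction "size G" arbitrary: G p rule: less_induct)
  case less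
  have "wins_first Right G' = wins_first Left G'" if "G' |\<in>| left_opts G" for G'
    using that less.hyps[of G' Right] impartial_opt[OF less.prems] size_opts[of G' Left G] by simp
  then show ?case
    unfolding wins_first_iff[of _ G] impartial_opts_eq[OF less.prems] by (cases p) auto
qed

text \<open>By \<open>impartial_wins_first\<close>, the choice of Left is immaterial for impartial
  games: there this separates outcome N from outcome P.\<close>

definition next_wins :: "game \<Rightarrow> bool" where
  "next_wins G \<longleftrightarrow> wins_first Left G"

lemma next_wins_plus_iff:
  assumes "impartial G" and "impartial H"
  shows "next_wins (G + H) \<longleftrightarrow>
    left_opts G = {||} \<and> left_opts H = {||} \<or>
    (\<exists>G' |\<in>| left_opts G. \<not> next_wins (G' + H)) \<or>
    (\<exists>H' |\<in>| left_opts H. \<not> next_wins (G + H'))"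
proof -
  have "wins_first Right (G' + H) = next_wins (G' + H)" if "G' |\<in>| left_opts G" for G'
    using that assms by (metis impartial_opt impartial_plus impartial_wins_first next_wins_def)
  moreover have "wins_first Right (G + H') = next_wins (G + H')" if "H' |\<in>| left_opts H" for H'
    using that assms by (metis impartial_opt impartial_plus impartial_wins_first next_wins_def)
  ultimately show ?thesis
    unfolding next_wins_def[of "G + H"] wins_first_iff[of Left "G + H"]
    by (auto simp: opts_plus)
qed

lemma next_wins_moveI:
  assumes "impartial G" and "impartial H"
  shows "G' |\<in>| left_opts G \<Longrightarrow> \<not> next_wins (G' + H) \<Longrightarrow> next_wins (G + H)"
    and "H' |\<in>| left_opts H \<Longrightarrow> \<not> next_wins (G + H') \<Longrightarrow> next_wins (G + H)"
  using next_wins_plus_iff[OF assms] by auto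

text \<open>Nonempty options of \<open>H\<close> exclude a sum without moves, which the player to
  move wins under misere play.\<close>

lemma not_next_winsI:
  assumes "impartial G" and "impartial H"
    and "left_opts H \<noteq> {||}"
    and "\<And>G'. G' |\<in>| left_opts G \<Longrightarrow> next_wins (G' + H)"
    and "\<And>H'. H' |\<in>| left_opts H \<Longrightarrow> next_wins (G + H')"
  shows "\<not> next_wins (G + H)"
  using assms by (auto simp: next_wins_plus_iff)

lemma misere_equiv_impartials_iff:
  assumes "impartial G" and "impartial H"
  shows "misere_equiv impartials G H \<longleftrightarrow>
    (\<forall>X. impartial X \<longrightarrow> next_wins (G + X) = next_wins (H + X))"
  using assms impartial_wins_first[OF impartial_plus]
  unfolding misere_equiv_iff impartials_def next_wins_def by blast

section \<open>Mates, distinguishing games and linked games\<close>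

lemma impartial_zero: "impartial 0"
  unfolding zero_game_def by (rule impartial_node) simp

text \<open>Conway's mate, the misere substitute for a negative: a recursive copy, except that an
  ended game receives one extra move to \<open>0\<close> to shift the parity.\<close>

fun mate :: "game \<Rightarrow> game" where
  "mate (Game A B) =
     (if A = {||} then Game {|0|} {|0|} else Game (mate |`| A) (mate |`| A))"

lemma left_opts_mate:
  "left_opts (mate G) = (if left_opts G = {||} then {|0|} else mate |`| left_opts G)"
  by (cases G) auto

lemma impartial_mate: "impartial G \<Longrightarrow> impartial (mate G)"
  by (induction rule: impartial.induct) (auto intro!: impartial_node impartial_zero)

text \<open>The second player restores a pair \<open>G' + mate G'\<close> after each move. Once
  \<open>G\<close> has no options, the only move is from \<open>mate G\<close> to \<open>0\<close>,
  which leaves the second player without a move and so the winner.\<close>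

lemma not_next_wins_mate: "impartial G \<Longrightarrow> \<not> next_wins (G + mate G)"
proof (induction "size G" arbitrary: G rule: less_induct)
  case less
  note imp = less.prems impartial_mate[OF less.prems]
  have opt: "impartial G'" "impartial (mate G')" "\<not> next_wins (G' + mate G')"
    if "G' |\<in>| left_opts G" for G'
    using that less impartial_opt impartial_mate size_opts[of G' Left G] by auto
  show ?case
  proof (rule not_next_winsI[OF imp])
    show "left_opts (mate G) \<noteq> {||}"
      by (simp add: left_opts_mate)
  next
    fix G' assume G': "G' |\<in>| left_opts G"
    then have "mate G' |\<in>| left_opts (mate G)"
      by (auto simp: left_opts_mate)
    then show "next_wins (G' + mate G)"
      using next_wins_moveI(2) opt[OF G'] imp by blast
  next
    fix M assume M: "M |\<in>| left_opts (mate G)"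
    show "next_wins (G + M)"
    proof (cases "left_opts G = {||}")
      case True
      then have "M = 0"
        using M by (simp add: left_opts_mate)
      then show ?thesis
        using True next_wins_plus_iff[OF less.prems impartial_zero] by (simp add: zero_game_def)
    next
      case False
      then obtain G' where "G' |\<in>| left_opts G" "M = mate G'"
        using M by (auto simp: left_opts_mate)
      then show ?thesis
        using next_wins_moveI(1) opt less.prems by blast
    qed
  qed
qed

text \<open>
  If a distinguishing game gives the outcomes the wrong way round, offering it as an option next
  to the mates of the options of \<open>G\<close> exchanges them.
\<close>

lemma distinguish_previous:
  assumes G: "impartial G" and H: "impartial H" and "\<not> misere_equiv impartials G H"
  obtains T where "impartial T" and "\<not> next_wins (G + T)" and "next_wins (H + T)"
proof -
  obtain X where X: "impartial X" and diff: "next_wins (G + X) \<noteq> next_wins (H + X)"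
    using assms by (auto simp: misere_equiv_impartials_iff)
  show thesis
  proof (cases "next_wins (G + X)")
    case False
    then show thesis
      using that X diff by blast
  next
    case True
    let ?A = "finsert X (mate |`| left_opts G)"
    let ?T = "Game ?A ?A"
    have T: "impartial ?T"
      using X G by (auto intro!: impartial_node dest: impartial_opt impartial_mate)
    \<comment> \<open>In \<open>G + ?T\<close>, a move to \<open>G'\<close> or to
      \<open>mate G'\<close> is answered by completing the pair; the remaining move, to
      \<open>X\<close>, loses by \<open>True\<close>.\<close>
    have reply: "next_wins (G' + ?T)" "next_wins (G + mate G')" if "G' |\<in>| left_opts G" for G'
    proof -
      have G': "impartial G'"
        using G that by (rule impartial_opt)
      then show "next_wins (G' + ?T)"
        using next_wins_moveI(2)[OF _ T, of G' "mate G'"] not_next_wins_mate that by simp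
      show "next_wins (G + mate G')"
        using next_wins_moveI(1)[OF G impartial_mate that] G' not_next_wins_mate by blast
    qed
    have "\<not> next_wins (G + ?T)"
      using True reply by (intro not_next_winsI G T) auto
    moreover have "next_wins (H + ?T)"
      using True diff by (intro next_wins_moveI(2)[OF H T, of X]) auto
    ultimately show thesis
      using that T by blast
  qed
qed

text \<open>The options of \<open>T\<close> are games separating \<open>K\<close> from each
  \<open>H'\<close> and \<open>H\<close> from each \<open>K'\<close>, oriented so that
  \<open>H' + x H'\<close> and \<open>K' + y K'\<close> are second-player wins. Moves to either
  summand of such a pair are answered by the other; the cross terms \<open>K + x H'\<close> and
  \<open>H + y K'\<close> are first-player wins by choice.\<close>

lemma linked:
  assumes K: "impartial K" and H: "impartial H"
    and KH': "\<And>H'. H' |\<in>| left_opts H \<Longrightarrow> \<not> misere_equiv impartials K H'"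
    and K'H: "\<And>K'. K' |\<in>| left_opts K \<Longrightarrow> \<not> misere_equiv impartials K' H"
  obtains T where "impartial T" and "\<not> next_wins (K + T)" and "\<not> next_wins (H + T)"
proof -
  have "\<forall>H'. H' |\<in>| left_opts H \<longrightarrow>
      (\<exists>T. impartial T \<and> \<not> next_wins (H' + T) \<and> next_wins (K + T))"
    using KH' misere_equiv_sym distinguish_previous K impartial_opt[OF H] by metis
  then obtain x where x: "impartial (x H')" "\<not> next_wins (H' + x H')" "next_wins (K + x H')"
    if "H' |\<in>| left_opts H" for H'
    by metis
  have "\<forall>K'. K' |\<in>| left_opts K \<longrightarrow>
      (\<exists>T. impartial T \<and> \<not> next_wins (K' + T) \<and> next_wins (H + T))"
    using K'H distinguish_previous H impartial_opt[OF K] by metis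
  then obtain y where y: "impartial (y K')" "\<not> next_wins (K' + y K')" "next_wins (H + y K')"
    if "K' |\<in>| left_opts K" for K'
    by metis
  show thesis
  proof (cases "left_opts H = {||} \<and> left_opts K = {||}")
    case True
    \<comment> \<open>With no options to separate, the general \<open>T\<close> would be
      \<open>0\<close>, and a sum without moves is won by the player to move; \<open>mate 0\<close>
      supplies the single move required.\<close>
    have one: "impartial (mate 0)"
      by (rule impartial_mate[OF impartial_zero])
    have "K = 0" "H = 0"
      using True impartial_opts_eq[OF K, of Right] impartial_opts_eq[OF H, of Right]
      by (auto simp: zero_game_def game.expand)
    then show thesis
      using that[OF one] not_next_wins_mate[OF impartial_zero] by blast
  next
    case False
    let ?A = "x |`| left_opts H |\<union>| y |`| left_opts K"
    let ?T = "Game ?A ?A"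
    have T: "impartial ?T"
      using x y by (auto intro!: impartial_node)
    have "next_wins (K' + ?T)" "next_wins (K + y K')" if "K' |\<in>| left_opts K" for K'
      using that y[OF that] next_wins_moveI(2)[OF impartial_opt[OF K that] T, of "y K'"]
        next_wins_moveI(1)[OF K _ that] by auto
    moreover have "next_wins (H' + ?T)" "next_wins (H + x H')" if "H' |\<in>| left_opts H" for H'
      using that x[OF that] next_wins_moveI(2)[OF impartial_opt[OF H that] T, of "x H'"]
        next_wins_moveI(1)[OF H _ that] by auto
    moreover have "left_opts ?T \<noteq> {||}"
      using False by auto
    ultimately have "\<not> next_wins (K + ?T)" "\<not> next_wins (H + ?T)"
      using not_next_winsI[OF K T] not_next_winsI[OF H T] x(3) y(3) by fastforce+
    then show thesis
      using that T by blast
  qed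
qed

text \<open>Otherwise \<open>G'\<close> and \<open>H\<close> are linked by some \<open>T\<close>.
  Moving to \<open>G' + T\<close> then wins \<open>G + T\<close>, while \<open>H + T\<close> is a
  second-player win, against the equivalence.\<close>

lemma equiv_option_matched_or_reversible:
  assumes G: "impartial G" and H: "impartial H" and eq: "misere_equiv impartials G H"
    and G': "G' |\<in>| left_opts G"
  obtains (matched) H' where "H' |\<in>| left_opts H" and "misere_equiv impartials G' H'"
    | (reversible) G'' where "G'' |\<in>| left_opts G'" and "misere_equiv impartials G'' H"
proof -
  have False if unmatched: "\<nexists>H'. H' |\<in>| left_opts H \<and> misere_equiv impartials G' H'"
    and irreversible: "\<nexists>G''. G'' |\<in>| left_opts G' \<and> misere_equiv impartials G'' H"
  proof -
    obtain T where T: "impartial T" "\<not> next_wins (G' + T)" "\<not> next_wins (H + T)"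
      using linked[OF impartial_opt[OF G G'] H] unmatched irreversible by blast
    then have "next_wins (G + T)"
      using next_wins_moveI(1)[OF G _ G'] by blast
    then show False
      using T eq misere_equiv_impartials_iff[OF G H] by blast
  qed
  then show thesis
    using matched reversible by blast
qed

section \<open>Transfer of winning strategies to dicot contexts\<close>

lemma dicot_opt: "dicot X \<Longrightarrow> X' |\<in>| opts p X \<Longrightarrow> dicot X'"
  by (cases p) (auto elim: dicot.cases simp: zero_game_def)

lemma dicot_opts_empty: "dicot X \<Longrightarrow> opts p X = {||} \<Longrightarrow> X = 0"
  by (cases p) (auto elim: dicot.cases)

text \<open>Induction on the total size, with \<open>G\<close> and \<open>H\<close> both arbitrary
  so that the hypothesis also applies with their roles exchanged, as is needed after a move by
  \<open>p\<close>.\<close>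

lemma wins_first_dicot_transfer:
  assumes "impartial G" and "impartial H" and "misere_equiv impartials G H" and "dicot X"
    and "wins_first p (G + X)"
  shows "wins_first p (H + X)"
  using assms
proof (induction "size G + size H + size X" arbitrary: G H X p rule: less_induct)
  case less
  note G = less.prems(1) and H = less.prems(2) and eq = less.prems(3) and X = less.prems(4)
  let ?q = "opponent p"
  consider (no_move) "opts p (G + X) = {||}"
    | (move_X) X' where "X' |\<in>| opts p X" "\<not> wins_first ?q (G + X')"
    | (move_G) G' where "G' |\<in>| left_opts G" "\<not> wins_first ?q (G' + X)"
    using less.prems(5) unfolding wins_first_iff[of p "G + X"]
    by (auto simp: opts_plus impartial_opts_eq[OF G])
  then show ?case
  proof cases
    case no_move
    then have "X \<in> impartials"
      using dicot_opts_empty[OF X] impartial_zero by (auto simp: opts_plus_empty_iff impartials_def)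
    then show ?thesis
      using eq less.prems(5) by (auto simp: misere_equiv_iff)
  next
    case (move_X X')
    \<comment> \<open>A win for the opponent on \<open>H + X'\<close> would transfer back to
      \<open>G + X'\<close>.\<close>
    then have "\<not> wins_first ?q (H + X')"
      using less.hyps[of H G X' ?q] G H misere_equiv_sym[OF eq] dicot_opt[OF X] size_opts by force
    then show ?thesis
      using move_X(1) by (auto simp: wins_first_iff[of p "H + X"] opts_plus)
  next
    case (move_G G')
    note G' = impartial_opt[OF G move_G(1)] and size_G' = size_opts[of G' Left G]
    show ?thesis
      using G H eq move_G(1)
    proof (cases rule: equiv_option_matched_or_reversible)
      case (matched H')
      then have "\<not> wins_first ?q (H' + X)"
        using less.hyps[of H' G' X ?q] G' impartial_opt[OF H] misere_equiv_sym X move_G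
          size_G' size_opts[of H' Left H] by force
      then show ?thesis
        using matched(1) impartial_opts_eq[OF H] by (auto simp: wins_first_iff[of p "H + X"] opts_plus)
    next
      case (reversible G'')
      \<comment> \<open>The move to \<open>G''\<close> is treated as an imagined reply by the
        opponent. Player \<open>p\<close>, about to move, still wins \<open>G'' + X\<close>, and
        \<open>G''\<close> is a smaller game equivalent to \<open>H\<close>.\<close>
      then have "G'' + X |\<in>| opts ?q (G' + X)"
        by (simp add: opts_plus impartial_opts_eq[OF G'])
      then have "wins_first p (G'' + X)"
        using move_G(2) by (auto simp: wins_first_iff[of ?q "G' + X"])
      then show ?thesis
        using less.hyps[of G'' H X p] impartial_opt[OF G'] reversible H X move_G(1)
          size_G' size_opts[of G'' Left G'] by force
    qed
  qed
qed

theorem theorem4p6: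
  fixes G H :: game
  assumes "impartial G" and "impartial H"
    and "misere_equiv impartials G H"
  shows "misere_equiv dicots G H"
  using wins_first_dicot_transfer assms misere_equiv_sym[OF assms(3)]
  unfolding misere_equiv_iff[of dicots] by (auto simp: dicots_def)

end
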